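(* Let $G=(V,E)$ be a finite simple graph. For each subset $S\subseteq V$ with $|S|\ge 2$ that does not induce a clique of $G$, choose one pair $e_S=\{u_S,v_S\}\in\binom{S}{2}\smallsetminus E$. Let $C_G\subseteq\mathbb{R}^{2^V}$ be the cone of all $h\in\mathbb{R}^{2^V}$ satisfying: (1) $h_{\varnothing}=-h_{V}$; (2) $h_{S\smallsetminus\{u\}}+h_{S\smallsetminus\{v\}}=h_{S}+h_{S\smallsetminus\{u,v\}}$ for each $S\subseteq V$ with $|S|\ge 2$ not inducing a clique of $G$, where $\{u,v\}=e_S$ is the chosen pair; (3) $h_{S\cup\{u\}}+h_{S\cup\{v\}}\ge h_{S}+h_{S\cup\{u,v\}}$ for each $\{u,v\}\in E$ and each $S\subseteq N(u)\cap N(v)$. Then the deformation cone of the graphical zonotope $Z_G$ is $$\mathbb{DC}(Z_G)=\{D_h : h\in C_G\}.$$ Moreover this is an irredundant facet description: the equations (1)-(2) are linearly independent and their solution space is the linear span of $C_G$, each inequality in (3) (indexed by an edge $\{u,v\}\in E$ and a set $S\subseteq N(u)\cap N(v)$) defines a facet of $C_G$, and distinct indices $(\{u,v\},S)$ define distinct facets.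
   Context: $G=(V,E)$ is a finite simple graph, so $E\subseteq\binom{V}{2}$, where $\binom{X}{2}$ denotes the set of two-element subsets of $X$. A subset $S\subseteq V$ induces a clique if all pairs of distinct elements of $S$ are edges. $N(v)=\{u\in V:\{u,v\}\in E\}$ is the neighborhood of $v$. $(\mathbf{e}_v)_{v\in V}$ is the canonical basis of $\mathbb{R}^V$, and $2^V$ is the set of all subsets of $V$. The graphical zonotope is the Minkowski sum $Z_G=\sum_{\{u,v\}\in E}[\mathbf{e}_u,\mathbf{e}_v]\subset\mathbb{R}^V$ of line segments. A (nonempty) polytope $P\subset\mathbb{R}^V$ is a weak Minkowski summand, or deformation, of a polytope $R\subset\mathbb{R}^V$ if there are a scalar $\lambda\ge 0$ and a polytope $Q$ with $P+Q=\lambda R$. The deformation cone $\mathbb{DC}(R)$ is the set of all deformations of $R$. For $h\in\mathbb{R}^{2^V}$, $$D_h=\Big\{x\in\mathbb{R}^V : \sum_{v\in S}x_v-\sum_{v\notin S}x_v\le h_S\ \text{ for all } S\subseteq V\Big\}.$$ *)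

theory Defs
  imports "HOL-Analysis.Analysis"
begin

text \<open>
  The vertex set \<open>V\<close> is the universe of a finite type \<open>'v\<close>, and a graph is
  given by its set \<open>E\<close> of two-element edges. Thus \<open>real ^ 'v\<close> stands for
  \<open>\<real>\<^sup>V\<close> and \<open>real ^ ('v set)\<close> for the space of vectors indexed by subsets of \<open>V\<close>.
\<close>

definition simple_graph :: "'v::finite set set \<Rightarrow> bool" where
  "simple_graph E \<longleftrightarrow> (\<forall>e\<in>E. card e = 2)"

definition nbhd :: "'v::finite set set \<Rightarrow> 'v \<Rightarrow> 'v set" where
  "nbhd E v = {u. {u, v} \<in> E}"

definition induces_clique :: "'v::finite set set \<Rightarrow> 'v set \<Rightarrow> bool" where
  "induces_clique E S \<longleftrightarrow> (\<forall>u\<in>S. \<forall>v\<in>S. u \<noteq> v \<longrightarrow> {u, v} \<in> E)"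

definition nonclique_sets :: "'v::finite set set \<Rightarrow> 'v set set" where
  "nonclique_sets E = {S. 2 \<le> card S \<and> \<not> induces_clique E S}"

text \<open>
  Sums of sets are Minkowski sums (the instances of HOL-Library.Set_Algebras), with
  the singleton of the origin as the empty sum. For an edge \<open>{u, v}\<close> the summand is
  the segment between the basis vectors of \<open>u\<close> and \<open>v\<close>, see
  \<open>graphical_zonotope_summand\<close>.
\<close>

definition graphical_zonotope :: "'v::finite set set \<Rightarrow> (real ^ 'v) set" where
  "graphical_zonotope E = (\<Sum>e\<in>E. convex hull ((\<lambda>v. axis v 1) ` e))"

lemma graphical_zonotope_summand:
  "convex hull ((\<lambda>v. axis v 1 :: real ^ 'v::finite) ` {u, v})
     = closed_segment (axis u 1) (axis v 1)"
  by (simp add: segment_convex_hull)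

text \<open>
  The library predicate \<^const>\<open>polytope\<close> also holds of the empty set, which is
  excluded here.
\<close>

definition deformation_of ::
    "'a::euclidean_space set \<Rightarrow> 'a set \<Rightarrow> bool" (infix "deformation'_of" 50) where
  "P deformation_of R \<longleftrightarrow>
     polytope P \<and> P \<noteq> {} \<and>
     (\<exists>c\<ge>0. \<exists>Q. polytope Q \<and> Q \<noteq> {} \<and> P + Q = (*\<^sub>R) c ` R)"

definition deformation_cone :: "'a::euclidean_space set \<Rightarrow> 'a set set" where
  "deformation_cone R = {P. P deformation_of R}"

definition D_poly :: "real ^ ('v::finite set) \<Rightarrow> (real ^ 'v) set" where
  "D_poly h = {x. \<forall>S. (\<Sum>v\<in>S. x $ v) - (\<Sum>v\<in>UNIV - S. x $ v) \<le> h $ S}"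

text \<open>
  A choice of the pairs \<open>e\<^sub>S\<close> is represented by two functions giving its
  elements, so that \<open>e\<^sub>S = {us S, vs S}\<close>. Their values outside
  \<^term>\<open>nonclique_sets E\<close> are irrelevant.
\<close>

definition nonedge_choice ::
    "'v::finite set set \<Rightarrow> ('v set \<Rightarrow> 'v) \<Rightarrow> ('v set \<Rightarrow> 'v) \<Rightarrow> bool" where
  "nonedge_choice E us vs \<longleftrightarrow>
     (\<forall>S\<in>nonclique_sets E.
        us S \<in> S \<and> vs S \<in> S \<and> us S \<noteq> vs S \<and> {us S, vs S} \<notin> E)"

definition solution_space ::
    "'v::finite set set \<Rightarrow> ('v set \<Rightarrow> 'v) \<Rightarrow> ('v set \<Rightarrow> 'v) \<Rightarrow> (real ^ ('v set)) set" where
  "solution_space E us vs =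
     {h. h $ {} = - h $ UNIV \<and>
         (\<forall>S\<in>nonclique_sets E.
            h $ (S - {us S}) + h $ (S - {vs S}) = h $ S + h $ (S - {us S, vs S}))}"

definition inequality_index :: "'v::finite set set \<Rightarrow> 'v \<Rightarrow> 'v \<Rightarrow> 'v set \<Rightarrow> bool" where
  "inequality_index E u v S \<longleftrightarrow> {u, v} \<in> E \<and> S \<subseteq> nbhd E u \<inter> nbhd E v"

definition C_cone ::
    "'v::finite set set \<Rightarrow> ('v set \<Rightarrow> 'v) \<Rightarrow> ('v set \<Rightarrow> 'v) \<Rightarrow> (real ^ ('v set)) set" where
  "C_cone E us vs =
     {h \<in> solution_space E us vs.
        \<forall>u v S. inequality_index E u v S \<longrightarrow>
          h $ (S \<union> {u}) + h $ (S \<union> {v}) \<ge> h $ S + h $ (S \<union> {u, v})}"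

definition tight_face ::
    "'v::finite set set \<Rightarrow> ('v set \<Rightarrow> 'v) \<Rightarrow> ('v set \<Rightarrow> 'v) \<Rightarrow>
     'v \<Rightarrow> 'v \<Rightarrow> 'v set \<Rightarrow> (real ^ ('v set)) set" where
  "tight_face E us vs u v S =
     {h \<in> C_cone E us vs. h $ (S \<union> {u}) + h $ (S \<union> {v}) = h $ S + h $ (S \<union> {u, v})}"

text \<open>
  The family of coefficient vectors of the equations that define
  \<^const>\<open>solution_space\<close>: \<^const>\<open>None\<close> indexes the equation relating the empty and
  the full vertex set, and \<^term>\<open>Some S\<close> the equation of the non-clique \<open>S\<close>.
\<close>

definition equation_indices :: "'v::finite set set \<Rightarrow> 'v set option set" where
  "equation_indices E = insert None (Some ` nonclique_sets E)"

definition equation_coeffs ::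
    "('v set \<Rightarrow> 'v) \<Rightarrow> ('v set \<Rightarrow> 'v) \<Rightarrow> 'v::finite set option \<Rightarrow> real ^ ('v set)" where
  "equation_coeffs us vs i =
     (case i of
        None \<Rightarrow> axis {} 1 + axis UNIV 1
      | Some S \<Rightarrow> axis (S - {us S}) 1 + axis (S - {vs S}) 1
                  - axis S 1 - axis (S - {us S, vs S}) 1)"

lemma solution_space_eq_coeffs:
  "solution_space E us vs =
     {h. \<forall>i\<in>equation_indices E. equation_coeffs us vs i \<bullet> h = 0}"
  unfolding solution_space_def equation_indices_def equation_coeffs_def
  by (auto simp: inner_add_left inner_diff_left inner_axis' algebra_simps
      eq_neg_iff_add_eq_0)

end

theory Submission
  imports Defs
begin

text \<open>
  By Moebius inversion, the equations say that the Moebius coefficients of \<open>h\<close> vanish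
  outside the cliques. So the second differences of \<open>h\<close> vanish for all nonedges, and those
  of an edge \<open>{u, v}\<close> at \<open>S\<close> only depend on \<open>S \<inter> N(u) \<inter> N(v)\<close>; in particular every
  \<open>h\<close> in the cone is submodular and \<open>D\<^sub>h\<close> is a base polytope. The greedy algorithm
  gives \<open>D\<^sub>g + D\<^sub>h = D\<^sub>g\<^sub>+\<^sub>h\<close>. As the support vector \<open>z\<close> of the zonotope
  satisfies all inequalities strictly, \<open>cz - h\<close> lies in the cone for large \<open>c\<close>, and \<open>D\<^sub>h\<close>
  is a deformation. Conversely, a vertex of the zonotope maximizing several directions
  yields a point of a given summand that maximizes them all; this transfers the linearity of the
  support function from the zonotope to the summand, for the directions of a chain as well
  as across nonedges. Finally, for any two different inequalities some element of the cone is
  tight for the first one only; the sum of these elements over all second inequalities is a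
  relative interior point of the facet.
\<close>

section \<open>The equations and second differences\<close>

text \<open>A negated mixed second difference, signed so that submodularity reads as
  nonnegativity.\<close>

definition curv :: "'v::finite \<Rightarrow> 'v \<Rightarrow> 'v set \<Rightarrow> real ^ ('v set) \<Rightarrow> real" where
  "curv u v S h = h $ (S \<union> {u}) + h $ (S \<union> {v}) - h $ S - h $ (S \<union> {u, v})"

lemma linear_curv: "linear (curv u v S)"
  by (rule linearI) (auto simp: curv_def algebra_simps)

lemma curv_commute: "curv u v S h = curv v u S h"
  by (simp add: curv_def insert_commute add.commute)

text \<open>This crude bound lets one multiple of \<open>norm h\<close> control all second
  differences of \<open>h\<close> at once.\<close>

lemma curv_bound: "\<bar>curv u v S h\<bar> \<le> 4 * norm h"
proof -
  have "\<bar>h $ T\<bar> \<le> norm h" for T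
    by (rule component_le_norm_cart)
  from this[of "S \<union> {u}"] this[of "S \<union> {v}"] this[of S] this[of "S \<union> {u, v}"]
  show ?thesis unfolding curv_def by linarith
qed

text \<open>Removing the chosen pair from a non-clique gives the base set at which its equation
  becomes a vanishing second difference, the same functional as in the inequalities.\<close>

lemma solution_space_iff_curv:
  assumes "nonedge_choice E us vs"
  shows "h \<in> solution_space E us vs \<longleftrightarrow>
    h $ {} = - h $ UNIV \<and>
    (\<forall>S\<in>nonclique_sets E. curv (us S) (vs S) (S - {us S, vs S}) h = 0)"
proof -
  have "h $ (S - {us S}) + h $ (S - {vs S}) = h $ S + h $ (S - {us S, vs S}) \<longleftrightarrow>
      curv (us S) (vs S) (S - {us S, vs S}) h = 0"
    if "S \<in> nonclique_sets E" for S
  proof -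
    have "us S \<in> S" "vs S \<in> S" "us S \<noteq> vs S"
      using assms that by (auto simp: nonedge_choice_def)
    then have "S - {us S, vs S} \<union> {us S} = S - {vs S}" "S - {us S, vs S} \<union> {vs S} = S - {us S}"
      "S - {us S, vs S} \<union> {us S, vs S} = S"
      by auto
    then show ?thesis
      by (simp only: curv_def) linarith
  qed
  then show ?thesis
    by (auto simp: solution_space_def)
qed

lemma C_cone_iff_curv:
  "h \<in> C_cone E us vs \<longleftrightarrow> h \<in> solution_space E us vs \<and>
     (\<forall>u v S. inequality_index E u v S \<longrightarrow> 0 \<le> curv u v S h)"
  by (auto simp: C_cone_def curv_def algebra_simps)

lemma tight_face_iff_curv:
  "h \<in> tight_face E us vs u v S \<longleftrightarrow> h \<in> C_cone E us vs \<and> curv u v S h = 0"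
  by (auto simp: tight_face_def curv_def algebra_simps)

lemma subspace_solution_space: "subspace (solution_space E us vs)"
  unfolding solution_space_eq_coeffs
  by (auto simp: subspace_def inner_add_right)

lemma inequality_indexD:
  assumes "simple_graph E" "inequality_index E u v S"
  shows "{u, v} \<in> E" "u \<noteq> v" "u \<notin> S" "v \<notin> S"
proof -
  have loop: "{x} \<notin> E" for x
    using assms(1) by (force simp: simple_graph_def)
  show "{u, v} \<in> E" "u \<noteq> v" "u \<notin> S" "v \<notin> S"
    using assms(2) loop by (auto simp: inequality_index_def nbhd_def)
qed

section \<open>Moebius coefficients and second differences\<close>

lemma sum_Pow_insert:
  fixes c :: "'a set \<Rightarrow> real"
  assumes "finite S" "x \<notin> S"
  shows "sum c (Pow (insert x S)) = sum c (Pow S) + (\<Sum>K\<in>Pow S. c (insert x K))"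
proof -
  have inj: "inj_on (insert x) (Pow S)"
    using assms(2) by (intro inj_onI) (metis PowD insert_ident subset_iff)
  have "sum c (Pow (insert x S)) = sum c (Pow S) + sum c (insert x ` Pow S)"
    unfolding Pow_insert using assms by (intro sum.union_disjoint) auto
  then show ?thesis
    by (simp add: sum.reindex[OF inj] o_def)
qed

text \<open>Coefficients of sets that miss \<open>u\<close> or \<open>v\<close> cancel between the
  four terms; those of sets containing both occur only in the term of
  \<open>S \<union> {u, v}\<close>, with negative sign.\<close>

lemma curv_moebius:
  fixes h :: "real ^ ('v::finite set)"
  assumes h: "\<And>S. h $ S = sum c (Pow S)" and "u \<noteq> v" "u \<notin> S" "v \<notin> S"
  shows "curv u v S h = - (\<Sum>K\<in>Pow S. c (insert u (insert v K)))"
proof -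
  have "sum c (Pow (insert u (insert v S))) =
      sum c (Pow (insert v S)) + (\<Sum>K\<in>Pow (insert v S). c (insert u K))"
    using assms(2,3) by (intro sum_Pow_insert) auto
  moreover have "(\<Sum>K\<in>Pow (insert v S). c (insert u K)) =
      (\<Sum>K\<in>Pow S. c (insert u K)) + (\<Sum>K\<in>Pow S. c (insert u (insert v K)))"
    using sum_Pow_insert[of S v "\<lambda>K. c (insert u K)"] assms(4) by simp
  moreover have "sum c (Pow (insert u S)) = sum c (Pow S) + (\<Sum>K\<in>Pow S. c (insert u K))"
    using assms(3) by (intro sum_Pow_insert) auto
  ultimately show ?thesis
    by (simp add: curv_def h)
qed

text \<open>
  The equation of a non-clique \<open>S\<close> is a sum of Moebius coefficients over sets that
  contain the chosen nonedge, hence over non-cliques; all of them but the one of \<open>S\<close>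
  vanish by induction.
\<close>

lemma solution_space_moebius:
  assumes ch: "nonedge_choice E us vs" and h: "h \<in> solution_space E us vs"
  obtains c where "\<And>S. h $ S = sum c (Pow S)" "\<And>K. \<not> induces_clique E K \<Longrightarrow> c K = 0"
proof -
  \<comment> \<open>The alternating subset transform is an involution, so \<open>h\<close> is the
    transform of \<open>b\<close>; the sign in \<open>c\<close> turns this into a plain subset
    sum.\<close>
  define b where "b S = (\<Sum>T\<in>Pow S. (-1) ^ card T * h $ T)" for S :: "'a set"
  define c where "c K = (-1) ^ card K * b K" for K
  have hc: "h $ S = sum c (Pow S)" for S
    unfolding c_def by (rule inclusion_exclusion_symmetric) (auto simp: b_def)
  have "\<not> induces_clique E T \<Longrightarrow> c T = 0" for T
  proof (induction "card T" arbitrary: T rule: less_induct)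
    case less
    have "2 \<le> card T"
    proof (rule ccontr)
      assume "\<not> 2 \<le> card T"
      then have "card T \<le> 1" by simp
      then have "\<forall>x\<in>T. \<forall>y\<in>T. x = y" by (simp add: card_le_Suc0_iff_eq)
      then show False using less.prems by (auto simp: induces_clique_def)
    qed
    then have T: "T \<in> nonclique_sets E"
      using less.prems by (simp add: nonclique_sets_def)
    let ?u = "us T" and ?v = "vs T" and ?R = "T - {us T, vs T}"
    have uv: "?u \<in> T" "?v \<in> T" "?u \<noteq> ?v" "{?u, ?v} \<notin> E"
      using ch T by (auto simp: nonedge_choice_def)
    have "0 = curv ?u ?v ?R h"
      using h T solution_space_iff_curv[OF ch] by auto
    also have "\<dots> = - (\<Sum>K\<in>Pow ?R. c (insert ?u (insert ?v K)))"
      using hc uv by (intro curv_moebius) auto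
    also have "(\<Sum>K\<in>Pow ?R. c (insert ?u (insert ?v K))) =
        (\<Sum>K\<in>{?R}. c (insert ?u (insert ?v K)))"
    proof (rule sum.mono_neutral_right)
      show "\<forall>K\<in>Pow ?R - {?R}. c (insert ?u (insert ?v K)) = 0"
      proof
        fix K assume K: "K \<in> Pow ?R - {?R}"
        have "insert ?u (insert ?v K) \<subset> T" using K uv by auto
        moreover have "\<not> induces_clique E (insert ?u (insert ?v K))"
          using uv by (auto simp: induces_clique_def)
        ultimately show "c (insert ?u (insert ?v K)) = 0"
          by (intro less.hyps psubset_card_mono) auto
      qed
    qed auto
    also have "(\<Sum>K\<in>{?R}. c (insert ?u (insert ?v K))) = c T"
    proof -
      have "insert ?u (insert ?v ?R) = T" using uv by auto
      then show ?thesis by simp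
    qed
    finally show "c T = 0" by simp
  qed
  with hc show ?thesis using that by blast
qed

text \<open>A set containing a nonedge is no clique, so every coefficient in the Moebius formula
  vanishes. The chosen pairs therefore enforce the equations of all nonedges.\<close>

lemma curv_nonedge:
  assumes "nonedge_choice E us vs" "h \<in> solution_space E us vs"
    and "u \<noteq> v" "u \<notin> S" "v \<notin> S" "{u, v} \<notin> E"
  shows "curv u v S h = 0"
proof -
  obtain c where c: "\<And>S. h $ S = sum c (Pow S)" "\<And>K. \<not> induces_clique E K \<Longrightarrow> c K = 0"
    using solution_space_moebius assms(1,2) by blast
  have "c (insert u (insert v K)) = 0" for K
    using assms(3,6) by (intro c(2)) (auto simp: induces_clique_def)
  then show ?thesis
    using curv_moebius[OF c(1) assms(3-5)] by simp
qed

text \<open>A term with \<open>K \<subseteq> S\<close> survives only if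
  \<open>insert u (insert v K)\<close> is a clique, which forces \<open>K\<close> into the common
  neighborhood.\<close>

lemma curv_restrict:
  assumes "nonedge_choice E us vs" "h \<in> solution_space E us vs"
    and "u \<noteq> v" "u \<notin> S" "v \<notin> S"
  shows "curv u v S h = curv u v (S \<inter> (nbhd E u \<inter> nbhd E v)) h"
proof -
  obtain c where c: "\<And>S. h $ S = sum c (Pow S)" "\<And>K. \<not> induces_clique E K \<Longrightarrow> c K = 0"
    using solution_space_moebius assms(1,2) by blast
  have "(\<Sum>K\<in>Pow S. c (insert u (insert v K))) =
      (\<Sum>K\<in>Pow (S \<inter> (nbhd E u \<inter> nbhd E v)). c (insert u (insert v K)))"
  proof (rule sum.mono_neutral_right)
    show "\<forall>K\<in>Pow S - Pow (S \<inter> (nbhd E u \<inter> nbhd E v)). c (insert u (insert v K)) = 0"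
    proof
      fix K assume "K \<in> Pow S - Pow (S \<inter> (nbhd E u \<inter> nbhd E v))"
      then obtain x where "x \<in> K" "x \<in> S" "{x, u} \<notin> E \<or> {x, v} \<notin> E"
        by (auto simp: nbhd_def)
      then have "\<not> induces_clique E (insert u (insert v K))"
        using assms(4,5) by (force simp: induces_clique_def)
      then show "c (insert u (insert v K)) = 0" by (rule c(2))
    qed
  qed auto
  then show ?thesis
    using curv_moebius[OF c(1), of u v] assms(3-5) by simp
qed

lemma curv_nonneg:
  assumes "nonedge_choice E us vs" "h \<in> C_cone E us vs"
    and "u \<noteq> v" "u \<notin> S" "v \<notin> S"
  shows "0 \<le> curv u v S h"
proof (cases "{u, v} \<in> E")
  case True
  then have "inequality_index E u v (S \<inter> (nbhd E u \<inter> nbhd E v))"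
    by (auto simp: inequality_index_def)
  then show ?thesis
    using assms curv_restrict[OF assms(1) _ assms(3-5)] by (simp add: C_cone_iff_curv)
next
  case False
  then show ?thesis
    using assms curv_nonedge[OF assms(1) _ assms(3-5)] by (simp add: C_cone_iff_curv)
qed

text \<open>Adding one element to the base set lowers the increment of \<open>v\<close> by a second
  difference, which is nonnegative; adding the elements of \<open>T\<close> one by one gives the
  claim.\<close>

lemma submodular_insert:
  assumes "nonedge_choice E us vs" "h \<in> C_cone E us vs"
    and "S \<subseteq> T" "v \<notin> T"
  shows "h $ (insert v T) - h $ T \<le> h $ (insert v S) - h $ S"
proof -
  have "v \<notin> S \<union> A \<Longrightarrow> h $ (insert v (S \<union> A)) - h $ (S \<union> A) \<le> h $ (insert v S) - h $ S" for A
  proof (induction A rule: finite_induct[OF finite])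
    case (2 u A)
    show ?case
    proof (cases "u \<in> S \<union> A")
      case False
      then have "0 \<le> curv u v (S \<union> A) h"
        using 2(4) by (intro curv_nonneg[OF assms(1,2)]) auto
      moreover have "h $ (insert v (S \<union> A)) - h $ (S \<union> A) \<le> h $ (insert v S) - h $ S"
        using 2(3,4) by simp
      moreover have "S \<union> insert u A = S \<union> A \<union> {u}"
        "insert v (S \<union> A \<union> {u}) = S \<union> A \<union> {u, v}" "insert v (S \<union> A) = S \<union> A \<union> {v}"
        by auto
      ultimately show ?thesis
        by (simp only: curv_def)
    next
      case True
      then have "S \<union> insert u A = S \<union> A" by auto
      then show ?thesis using 2(3,4) by metis
    qed
  qed simp
  from this[of T] show ?thesis
    using assms(3,4) by (simp add: Un_absorb1)
qed

section \<open>Base polytopes of submodular functions\<close>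

text \<open>The normal vector of the inequality indexed by \<open>S\<close> in
  \<open>D_poly\<close>.\<close>

definition sign_vec :: "'v::finite set \<Rightarrow> real ^ 'v" where
  "sign_vec S = (\<chi> v. if v \<in> S then 1 else - 1)"

lemma inner_sign_vec: "sign_vec S \<bullet> x = (\<Sum>v\<in>S. x $ v) - (\<Sum>v\<in>UNIV - S. x $ v)"
proof -
  have "sign_vec S \<bullet> x = (\<Sum>v\<in>UNIV. (if v \<in> S then 1 else - 1) * x $ v)"
    by (simp add: inner_vec_def sign_vec_def)
  also have "\<dots> = (\<Sum>v\<in>UNIV. if v \<in> S then x $ v else - x $ v)"
    by (intro sum.cong) auto
  also have "\<dots> = (\<Sum>v\<in>S. x $ v) - (\<Sum>v\<in>UNIV - S. x $ v)"
    by (simp add: sum.If_cases sum_negf Compl_eq_Diff_UNIV)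
  finally show ?thesis .
qed

lemma inner_sign_vec_UNIV: "sign_vec S \<bullet> x = 2 * (\<Sum>v\<in>S. x $ v) - (\<Sum>v\<in>UNIV. x $ v)"
  unfolding inner_sign_vec by (simp add: sum_diff)

lemma mem_D_poly: "x \<in> D_poly h \<longleftrightarrow> (\<forall>S. sign_vec S \<bullet> x \<le> h $ S)"
  by (simp add: D_poly_def inner_sign_vec)

text \<open>Induction on the number of values of \<open>w\<close>: lower the largest value to the second largest.\<close>

lemma weighted_sum_nonneg:
  fixes w y :: "'v::finite \<Rightarrow> real"
  assumes "\<And>t. 0 \<le> (\<Sum>v | t \<le> w v. y v)" "(\<Sum>v\<in>UNIV. y v) = 0"
  shows "0 \<le> (\<Sum>v\<in>UNIV. w v * y v)"
  using assms(1)
proof (induction "card (range w)" arbitrary: w rule: less_induct)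
  case less
  define M where "M = Max (range w)"
  have M: "w v \<le> M" for v
    by (simp add: M_def)
  show ?case
  proof (cases "range w = {M}")
    case True
    then have "w v = M" for v by auto
    then show ?thesis using assms(2) by (simp flip: sum_distrib_left)
  next
    case False
    have "M \<in> range w" by (simp add: M_def)
    with False have ne: "range w - {M} \<noteq> {}" by auto
    define M' where "M' = Max (range w - {M})"
    have M': "M' \<in> range w - {M}" using ne unfolding M'_def by (intro Max_in) auto
    have M'_ge: "w v \<le> M'" if "w v \<noteq> M" for v
      using that by (simp add: M'_def)
    have "M' < M" using M' M by (metis DiffE image_iff insertI1 less_le)
    define w' where "w' v = min (w v) M'" for v
    have w': "w' v = (if w v = M then M' else w v)" for v
      using M'_ge \<open>M' < M\<close> by (auto simp: w'_def)
    have "range w' \<subseteq> range w - {M}" using M' by (auto simp: w')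
    then have "range w' \<subset> range w" using \<open>M \<in> range w\<close> by auto
    then have "card (range w') < card (range w)" by (simp add: psubset_card_mono)
    \<comment> \<open>Superlevel sets of \<open>w'\<close> agree with those of \<open>w\<close> up
      to the threshold \<open>M'\<close> and are empty above it.\<close>
    moreover have "0 \<le> (\<Sum>v | t \<le> w' v. y v)" for t
      using less.prems[of t] by (cases "t \<le> M'") (auto simp: w'_def)
    ultimately have "0 \<le> (\<Sum>v\<in>UNIV. w' v * y v)" by (rule less.hyps)
    moreover have "{v. M \<le> w v} = {v. w v = M}" using M by (auto intro: antisym)
    then have "0 \<le> (M - M') * (\<Sum>v | w v = M. y v)"
      using less.prems[of M] \<open>M' < M\<close> by simp
    moreover have "(\<Sum>v\<in>UNIV. w v * y v) = (\<Sum>v\<in>UNIV. w' v * y v + (if w v = M then (M - M') * y v else 0))"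
      by (intro sum.cong) (auto simp: w' algebra_simps)
    then have "(\<Sum>v\<in>UNIV. w v * y v) = (\<Sum>v\<in>UNIV. w' v * y v) + (M - M') * (\<Sum>v | w v = M. y v)"
      by (simp add: sum.distrib sum.If_cases sum_distrib_left)
    ultimately show ?thesis by linarith
  qed
qed

text \<open>Up to a constant vector, \<open>w\<close> is a nonnegative combination of indicators of
  its superlevel sets, and the constant does not matter because \<open>x\<close> and
  \<open>y\<close> have equal coordinate sums.\<close>

lemma inner_le_of_level_sets:
  fixes w x y :: "real ^ 'v::finite"
  assumes "\<And>t. sign_vec {v. t \<le> w $ v} \<bullet> x \<le> sign_vec {v. t \<le> w $ v} \<bullet> y"
  shows "w \<bullet> x \<le> w \<bullet> y"
proof -
  define z where "z = y - x"
  have z: "0 \<le> sign_vec {v. t \<le> w $ v} \<bullet> z" for t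
    using assms[of t] by (simp add: z_def inner_diff_right)
  \<comment> \<open>Thresholds below and above all values of \<open>w\<close> produce the full and
    the empty set; their sign vectors are opposite, so the coordinate sum of \<open>z\<close> is
    zero.\<close>
  have "0 \<le> sign_vec UNIV \<bullet> z" "0 \<le> sign_vec {} \<bullet> z"
  proof -
    have "{v. Min (range (($) w)) \<le> w $ v} = UNIV" by auto
    then show "0 \<le> sign_vec UNIV \<bullet> z" using z[of "Min (range (($) w))"] by simp
    have "w $ v < Max (range (($) w)) + 1" for v
      by (smt (verit) Max_ge finite_imageI finite rangeI)
    then have "{v. Max (range (($) w)) + 1 \<le> w $ v} = {}" by (auto simp: not_le)
    then show "0 \<le> sign_vec {} \<bullet> z" using z[of "Max (range (($) w)) + 1"] by simp
  qed
  then have 0: "(\<Sum>v\<in>UNIV. z $ v) = 0"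
    by (simp add: inner_sign_vec_UNIV)
  have "0 \<le> (\<Sum>v\<in>UNIV. w $ v * z $ v)"
    using z 0 by (intro weighted_sum_nonneg) (auto simp: inner_sign_vec_UNIV)
  then show ?thesis
    by (simp add: z_def inner_vec_def algebra_simps sum_subtractf)
qed

text \<open>A hyperplane separating \<open>x\<close> from \<open>P\<close> would have a direction in
  which \<open>x\<close> exceeds all of \<open>P\<close>; the dominating point for that direction
  excludes this.\<close>

lemma mem_polytope_if_dominated:
  fixes P :: "(real ^ 'v::finite) set"
  assumes "polytope P" "P \<noteq> {}"
    and "\<And>w :: real ^ 'v. \<exists>p\<in>P. \<forall>t. sign_vec {v. t \<le> w $ v} \<bullet> x \<le> sign_vec {v. t \<le> w $ v} \<bullet> p"
  shows "x \<in> P"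
proof (rule ccontr)
  assume "x \<notin> P"
  then obtain a :: "real ^ 'v" and b where ab: "a \<bullet> x < b" "\<forall>p\<in>P. b < a \<bullet> p"
    using separating_hyperplane_closed_point[of P x] assms(1)
      polytope_imp_convex polytope_imp_closed by blast
  obtain p where p: "p \<in> P"
    "\<And>t. sign_vec {v. t \<le> (- a) $ v} \<bullet> x \<le> sign_vec {v. t \<le> (- a) $ v} \<bullet> p"
    using assms(3)[of "- a"] by blast
  have "(- a) \<bullet> x \<le> (- a) \<bullet> p"
    using p(2) by (rule inner_le_of_level_sets)
  with ab p(1) show False by force
qed

text \<open>Boundedness holds for every \<open>h\<close>: the inequalities of \<open>{v}\<close> and
  \<open>UNIV\<close> bound coordinate \<open>v\<close> above, those of \<open>- {v}\<close> and
  \<open>{}\<close> bound it below.\<close>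

lemma polytope_D_poly: "polytope (D_poly h)"
proof -
  have D: "D_poly h = (\<Inter>S. {x. sign_vec S \<bullet> x \<le> h $ S})"
    by (auto simp: mem_D_poly)
  have "polyhedron (D_poly h)"
    unfolding D by (intro polyhedron_Inter) (auto simp: polyhedron_halfspace_le)
  moreover have "bounded (D_poly h)"
  proof (rule bounded_subset)
    let ?b = "\<chi> v. (\<bar>h $ {v}\<bar> + \<bar>h $ (- {v})\<bar> + \<bar>h $ UNIV\<bar> + \<bar>h $ {}\<bar>)"
    show "bounded (cbox (- ?b) ?b)" by simp
    show "D_poly h \<subseteq> cbox (- ?b) ?b"
    proof
      fix x assume "x \<in> D_poly h"
      then have x: "sign_vec S \<bullet> x \<le> h $ S" for S by (simp add: mem_D_poly)
      have "\<bar>x $ v\<bar> \<le> ?b $ v" for v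
      proof -
        have "(\<Sum>u\<in>- {v}. x $ u) = (\<Sum>u\<in>UNIV. x $ u) - x $ v"
          by (simp add: Compl_eq_Diff_UNIV sum_diff)
        then show ?thesis
          using x[of "{v}"] x[of "- {v}"] x[of UNIV] x[of "{}"]
          by (simp add: inner_sign_vec_UNIV abs_if split: if_splits)
      qed
      then show "x \<in> cbox (- ?b) ?b"
        by (auto simp: mem_box_cart abs_le_iff) (smt (verit))+
    qed
  qed
  ultimately show ?thesis by (simp add: polytope_eq_bounded_polyhedron)
qed

section \<open>The greedy point and Minkowski additivity\<close>

text \<open>Vertices are ranked by decreasing \<open>w\<close> with ties broken arbitrarily, so that
  superlevel sets of \<open>w\<close> become initial segments.\<close>

lemma order_refinement:
  fixes w :: "'v::finite \<Rightarrow> real"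
  obtains r :: "'v \<Rightarrow> nat" where "inj r" "\<And>u v. w v < w u \<Longrightarrow> r u < r v"
proof -
  obtain f :: "'v \<Rightarrow> nat" where f: "inj f"
    using finite_imp_inj_to_nat_seg[OF finite, of "UNIV :: 'v set"] by auto
  define lt where "lt u v \<longleftrightarrow> w v < w u \<or> w u = w v \<and> f u < f v" for u v
  define r where "r v = card {u. lt u v}" for v
  have mono: "r u < r v" if "lt u v" for u v
    unfolding r_def using that by (intro psubset_card_mono) (auto simp: lt_def)
  have "inj r"
  proof (rule injI, rule ccontr)
    fix u v assume "r u = r v" "u \<noteq> v"
    then have "lt u v \<or> lt v u" using f by (auto simp: lt_def not_less le_less inj_eq)
    then show False using mono \<open>r u = r v\<close> by fastforce
  qed
  then show ?thesis using that mono by (auto simp: lt_def)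
qed

text \<open>
  Edmonds' greedy algorithm: the increments of \<open>h\<close> along a linear order of the
  vertices give a point at which all initial segments of the order are tight. It depends
  linearly on \<open>h\<close>.
\<close>

definition greedy :: "('v::finite \<Rightarrow> nat) \<Rightarrow> real ^ ('v set) \<Rightarrow> real ^ 'v" where
  "greedy r h = (\<chi> v. (h $ {u. r u \<le> r v} - h $ {u. r u < r v}) / 2)"

lemma greedy_add: "greedy r (g + h) = greedy r g + greedy r h"
  by (simp add: greedy_def vec_eq_iff field_simps)

text \<open>Remove the vertex \<open>v\<close> of largest rank from \<open>S\<close>. The rest lies
  in the initial segment before \<open>v\<close>, so submodularity bounds the greedy increment at
  \<open>v\<close> by that of \<open>h\<close> from the rest to \<open>S\<close>; for an initial
  segment \<open>S\<close> the two coincide.\<close>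

lemma greedy_sum:
  assumes "nonedge_choice E us vs" "h \<in> C_cone E us vs" "inj r"
  shows "2 * (\<Sum>v\<in>S. greedy r h $ v) \<le> h $ S - h $ {} \<and>
    ((\<forall>v\<in>S. \<forall>u. r u < r v \<longrightarrow> u \<in> S) \<longrightarrow> 2 * (\<Sum>v\<in>S. greedy r h $ v) = h $ S - h $ {})"
proof (induction "card S" arbitrary: S rule: less_induct)
  case less
  show ?case
  proof (cases "S = {}")
    case False
    obtain v where v: "v \<in> S" "\<And>u. u \<in> S \<Longrightarrow> r u \<le> r v"
      using obtains_MAX[of S r thesis] False finite[of S] Max_ge[of "r ` S"] by (metis finite_imageI image_eqI)
    define T where "T = S - {v}"
    have S: "S = insert v T" "v \<notin> T" using v by (auto simp: T_def)
    have "{u. r u \<le> r v} = insert v {u. r u < r v}"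
      using \<open>inj r\<close> by (auto simp: le_less inj_eq)
    then have g: "2 * greedy r h $ v = h $ (insert v {u. r u < r v}) - h $ {u. r u < r v}"
      by (simp add: greedy_def)
    have T_sub: "T \<subseteq> {u. r u < r v}"
      using v \<open>inj r\<close> by (auto simp: T_def le_less inj_eq)
    have sum_S: "(\<Sum>v\<in>S. greedy r h $ v) = greedy r h $ v + (\<Sum>v\<in>T. greedy r h $ v)"
      unfolding S(1) using S(2) by simp
    have "card T < card S" unfolding S(1) using S(2) by simp
    note IH = less.hyps[OF this]
    have "h $ (insert v {u. r u < r v}) - h $ {u. r u < r v} \<le> h $ S - h $ T"
      unfolding S(1) by (rule submodular_insert[OF assms(1,2) T_sub]) simp
    then have "2 * (\<Sum>v\<in>S. greedy r h $ v) \<le> h $ S - h $ {}"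
      using IH g sum_S by (simp add: distrib_left)
    moreover have "2 * (\<Sum>v\<in>S. greedy r h $ v) = h $ S - h $ {}"
      if down: "\<forall>v\<in>S. \<forall>u. r u < r v \<longrightarrow> u \<in> S"
    proof -
      have T_eq: "T = {u. r u < r v}" using T_sub down v(1) by (auto simp: T_def)
      have "\<forall>v\<in>T. \<forall>u. r u < r v \<longrightarrow> u \<in> T" by (auto simp: T_eq)
      with IH have "2 * (\<Sum>v\<in>T. greedy r h $ v) = h $ T - h $ {}" by blast
      then show ?thesis using g sum_S unfolding S(1) T_eq[symmetric] by (simp add: distrib_left)
    qed
    ultimately show ?thesis by blast
  qed simp
qed

text \<open>By \<open>h $ {} = - h $ UNIV\<close> the coordinates of the greedy point add up to
  \<open>h $ UNIV\<close>, which cancels the offset \<open>- h $ {}\<close> in the bound on partial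
  sums.\<close>

lemma greedy_mem_D_poly:
  assumes "nonedge_choice E us vs" "h \<in> C_cone E us vs" "inj r"
  shows "greedy r h \<in> D_poly h"
    and "\<lbrakk>\<And>u v. v \<in> S \<Longrightarrow> r u < r v \<Longrightarrow> u \<in> S\<rbrakk> \<Longrightarrow> sign_vec S \<bullet> greedy r h = h $ S"
proof -
  have h0: "h $ {} = - h $ UNIV"
    using assms(2) by (simp add: C_cone_def solution_space_def)
  have U: "2 * (\<Sum>v\<in>UNIV. greedy r h $ v) = h $ UNIV - h $ {}"
    using greedy_sum[OF assms, of UNIV] by simp
  show "greedy r h \<in> D_poly h"
    unfolding mem_D_poly inner_sign_vec_UNIV
  proof
    fix S
    show "2 * (\<Sum>v\<in>S. greedy r h $ v) - (\<Sum>v\<in>UNIV. greedy r h $ v) \<le> h $ S"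
      using greedy_sum[OF assms, of S] U h0 by simp
  qed
  show "sign_vec S \<bullet> greedy r h = h $ S" if "\<And>u v. v \<in> S \<Longrightarrow> r u < r v \<Longrightarrow> u \<in> S"
    using greedy_sum[OF assms, of S] U h0 that unfolding inner_sign_vec_UNIV by auto
qed

lemma D_poly_nonempty:
  assumes "nonedge_choice E us vs" "h \<in> C_cone E us vs"
  shows "D_poly h \<noteq> {}"
proof -
  obtain r :: "'a \<Rightarrow> nat" where "inj r"
    using order_refinement[of "\<lambda>_. 0"] by metis
  then show ?thesis using greedy_mem_D_poly(1)[OF assms] by blast
qed

lemma polytope_set_plus:
  assumes "polytope P" "polytope Q"
  shows "polytope (P + Q)"
proof -
  obtain A B where "finite A" "P = convex hull A" "finite B" "Q = convex hull B"
    using assms by (auto simp: polytope_def)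
  then have "P + Q = convex hull (A + B)" "finite (A + B)"
    by (auto simp: convex_hull_set_plus finite_set_plus)
  then show ?thesis
    unfolding polytope_def by blast
qed

text \<open>The greedy point of \<open>g + h\<close> splits into those of \<open>g\<close> and
  \<open>h\<close> and is tight at all superlevel sets of a given direction, so it dominates every
  point of \<open>D_poly (g + h)\<close> there.\<close>

lemma D_poly_add:
  assumes "nonedge_choice E us vs" "g \<in> C_cone E us vs" "h \<in> C_cone E us vs"
    "g + h \<in> C_cone E us vs"
  shows "D_poly g + D_poly h = D_poly (g + h)"
proof
  show "D_poly g + D_poly h \<subseteq> D_poly (g + h)"
    by (auto simp: mem_D_poly inner_add_right add_mono elim!: set_plus_elim)
  show "D_poly (g + h) \<subseteq> D_poly g + D_poly h"
  proof
    fix x assume x: "x \<in> D_poly (g + h)"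
    show "x \<in> D_poly g + D_poly h"
    proof (rule mem_polytope_if_dominated)
      show "polytope (D_poly g + D_poly h)"
        by (simp add: polytope_set_plus polytope_D_poly)
      show "D_poly g + D_poly h \<noteq> {}"
        using D_poly_nonempty[OF assms(1,2)] D_poly_nonempty[OF assms(1,3)]
        by (auto simp: set_plus_def)
      show "\<exists>p\<in>D_poly g + D_poly h.
          \<forall>t. sign_vec {v. t \<le> w $ v} \<bullet> x \<le> sign_vec {v. t \<le> w $ v} \<bullet> p" for w :: "real ^ 'a"
      proof -
        obtain r where r: "inj r" "\<And>u v. w $ v < w $ u \<Longrightarrow> r u < (r v :: nat)"
          using order_refinement[of "\<lambda>v. w $ v"] by metis
        have "greedy r (g + h) \<in> D_poly g + D_poly h"
          unfolding greedy_add
          using greedy_mem_D_poly(1) assms(1-3) r(1) by (intro set_plus_intro) blast+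
        moreover have "sign_vec {v. t \<le> w $ v} \<bullet> greedy r (g + h) = (g + h) $ {v. t \<le> w $ v}" for t
        proof (rule greedy_mem_D_poly(2)[OF assms(1,4) r(1)])
          show "u \<in> {v. t \<le> w $ v}" if "v \<in> {v. t \<le> w $ v}" "r u < r v" for u v
            using that r(2)[of u v] by force
        qed
        ultimately show ?thesis
          using x unfolding mem_D_poly by metis
      qed
    qed
  qed
qed

section \<open>Deformations of the graphical zonotope\<close>

lemma simple_graph_edge:
  assumes "simple_graph E" "e \<in> E"
  shows "e \<noteq> {}" and "u \<in> e \<Longrightarrow> v \<in> e \<Longrightarrow> u \<noteq> v \<Longrightarrow> e = {u, v}"
proof -
  have c: "card e = 2" using assms by (simp add: simple_graph_def)
  then show "e \<noteq> {}" by auto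
  show "e = {u, v}" if "u \<in> e" "v \<in> e" "u \<noteq> v"
    using c that by (intro card_subset_eq[symmetric]) auto
qed

lemma polytope_graphical_zonotope: "polytope (graphical_zonotope E)"
proof -
  have "polytope (\<Sum>e\<in>F. convex hull ((\<lambda>v. axis v 1 :: real ^ 'a) ` e))" for F :: "'a set set"
  proof (induction F rule: finite_induct[OF finite])
    case 1
    then show ?case by (simp add: set_zero polytope_sing)
  next
    case (2 e F)
    then show ?case by (simp add: polytope_set_plus polytope_convex_hull)
  qed
  then show ?thesis by (simp add: graphical_zonotope_def)
qed

lemma vertex_sum_mem_graphical_zonotope:
  assumes "\<And>e. e \<in> E \<Longrightarrow> f e \<in> e"
  shows "(\<Sum>e\<in>E. axis (f e) 1) \<in> graphical_zonotope E"
  unfolding graphical_zonotope_def set_sum_alt[OF finite]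
  using assms by (intro CollectI exI[of _ "\<lambda>e. axis (f e) 1"] conjI ballI refl hull_inc imageI)

text \<open>A linear functional is maximal on a segment at an endpoint, and maxima add over
  Minkowski sums.\<close>

lemma inner_graphical_zonotope_le:
  assumes "x \<in> graphical_zonotope E" "\<And>e v. e \<in> E \<Longrightarrow> v \<in> e \<Longrightarrow> d $ v \<le> d $ (f e)"
  shows "d \<bullet> x \<le> (\<Sum>e\<in>E. d $ (f e))"
proof -
  obtain s where x: "x = sum s E" and s: "\<And>e. e \<in> E \<Longrightarrow> s e \<in> convex hull ((\<lambda>v. axis v 1) ` e)"
    using assms(1) unfolding graphical_zonotope_def set_sum_alt[OF finite] by blast
  have "d \<bullet> s e \<le> d $ (f e)" if "e \<in> E" for e
  proof -
    have "convex hull ((\<lambda>v. axis v 1) ` e) \<subseteq> {y. d \<bullet> y \<le> d $ (f e)}"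
      using assms(2)[OF that] by (intro hull_minimal convex_halfspace_le) (auto simp: inner_axis)
    then show ?thesis using s[OF that] by blast
  qed
  then show ?thesis unfolding x inner_sum_right by (intro sum_mono)
qed

text \<open>
  A point of \<open>P\<close> that, together with a point of \<open>Q\<close>, adds up to a vertex of the
  zonotope maximizes every direction that the vertex maximizes.
\<close>

lemma summand_common_maximizer:
  assumes PQ: "P + Q = (*\<^sub>R) c ` graphical_zonotope E" and "0 \<le> c"
    and f: "\<And>e. e \<in> E \<Longrightarrow> f e \<in> e"
  shows "\<exists>p\<in>P. \<forall>d. (\<forall>e\<in>E. \<forall>v\<in>e. d $ v \<le> d $ (f e)) \<longrightarrow> (\<forall>x\<in>P. d \<bullet> x \<le> d \<bullet> p)"
proof -
  define z where "z = (\<Sum>e\<in>E. axis (f e) (1::real))"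
  have "z \<in> graphical_zonotope E"
    unfolding z_def by (rule vertex_sum_mem_graphical_zonotope[OF f])
  then have "c *\<^sub>R z \<in> P + Q" unfolding PQ by blast
  then obtain p q where pq: "p \<in> P" "q \<in> Q" "c *\<^sub>R z = p + q"
    by (rule set_plus_elim) auto
  have "d \<bullet> x \<le> d \<bullet> p" if d: "\<forall>e\<in>E. \<forall>v\<in>e. d $ v \<le> d $ (f e)" and "x \<in> P" for d x
  proof -
    have "x + q \<in> P + Q" using pq(2) \<open>x \<in> P\<close> by (rule set_plus_intro[rotated])
    then obtain y where y: "y \<in> graphical_zonotope E" "x + q = c *\<^sub>R y" unfolding PQ by blast
    have "d \<bullet> y \<le> d \<bullet> z"
      using inner_graphical_zonotope_le[OF y(1), of d f] d by (simp add: z_def inner_sum_right inner_axis)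
    then have "d \<bullet> (x + q) \<le> d \<bullet> (p + q)"
      unfolding y(2) pq(3)[symmetric] using \<open>0 \<le> c\<close> by (simp add: mult_left_mono)
    then show ?thesis by (simp add: inner_add_right)
  qed
  with pq(1) show ?thesis by blast
qed

text \<open>Here \<open>h\<close> lists the support values of the summand \<open>P\<close> in the
  sign directions. Points of \<open>P\<close> at which many of these values are attained together
  force the linear relations and dominate \<open>D_poly h\<close>.\<close>

lemma deformation_eq_D_poly:
  fixes h :: "real ^ ('v::finite set)"
  assumes G: "simple_graph E" and ch: "nonedge_choice E us vs"
    and P: "polytope P" "P \<noteq> {}"
    and PQ: "P + Q = (*\<^sub>R) c ` graphical_zonotope E" and "0 \<le> c"
    and h_att: "\<And>S. \<exists>p\<in>P. sign_vec S \<bullet> p = h $ S"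
    and h_max: "\<And>S x. x \<in> P \<Longrightarrow> sign_vec S \<bullet> x \<le> h $ S"
  shows "h \<in> C_cone E us vs" and "P = D_poly h"
proof -
  \<comment> \<open>Taking at each edge an endpoint of largest \<open>w\<close> picks a vertex of
    the zonotope; it maximizes the sign vector of each \<open>S\<close> such that \<open>w\<close>
    strictly drops along all edges leaving \<open>S\<close>.\<close>
  have common: "\<exists>p\<in>P. \<forall>S. (\<forall>x y. {x, y} \<in> E \<longrightarrow> x \<in> S \<longrightarrow> y \<notin> S \<longrightarrow> w y < w x) \<longrightarrow>
      sign_vec S \<bullet> p = h $ S" for w :: "'v \<Rightarrow> real"
  proof -
    have "\<exists>x. x \<in> e \<and> (\<forall>y\<in>e. w y \<le> w x)" if "e \<in> E" for e
    proof -
      have "w ` e \<noteq> {}" using simple_graph_edge(1)[OF G that] by simp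
      then have "Max (w ` e) \<in> w ` e" by (intro Max_in) auto
      then obtain x where "x \<in> e" "w x = Max (w ` e)" by auto
      then show ?thesis by (intro exI[of _ x]) simp
    qed
    then obtain f where f: "\<And>e. e \<in> E \<Longrightarrow> f e \<in> e" "\<And>e y. e \<in> E \<Longrightarrow> y \<in> e \<Longrightarrow> w y \<le> w (f e)"
      using bchoice[of E "\<lambda>e x. x \<in> e \<and> (\<forall>y\<in>e. w y \<le> w x)"] by blast
    obtain p where p: "p \<in> P"
      "\<forall>d. (\<forall>e\<in>E. \<forall>v\<in>e. d $ v \<le> d $ (f e)) \<longrightarrow> (\<forall>x\<in>P. d \<bullet> x \<le> d \<bullet> p)"
      using summand_common_maximizer[OF PQ \<open>0 \<le> c\<close> f(1)] by blast
    have "sign_vec S \<bullet> p = h $ S"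
      if S: "\<forall>x y. {x, y} \<in> E \<longrightarrow> x \<in> S \<longrightarrow> y \<notin> S \<longrightarrow> w y < w x" for S
    proof -
      obtain x where x: "x \<in> P" "sign_vec S \<bullet> x = h $ S" using h_att by blast
      have "sign_vec S $ v \<le> sign_vec S $ (f e)" if "e \<in> E" "v \<in> e" for e v
      proof (rule ccontr)
        assume "\<not> ?thesis"
        then have vf: "v \<in> S" "f e \<notin> S" by (auto simp: sign_vec_def split: if_splits)
        then have "e = {v, f e}"
          using that f(1) by (intro simple_graph_edge(2)[OF G]) auto
        with S vf \<open>e \<in> E\<close> have "w (f e) < w v" by metis
        with f(2)[OF that] show False by simp
      qed
      then have "sign_vec S \<bullet> x \<le> sign_vec S \<bullet> p" using x(1) p(2) by blast
      with x(2) h_max[OF p(1), of S] show ?thesis by simp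
    qed
    with p(1) show ?thesis by blast
  qed
  have sv: "sign_vec (S \<union> {u}) + sign_vec (S \<union> {v}) = sign_vec S + sign_vec (S \<union> {u, v})"
    if "u \<noteq> v" "u \<notin> S" "v \<notin> S" for u v and S :: "'v set"
    using that by (auto simp: vec_eq_iff sign_vec_def)
  \<comment> \<open>One point is tight at \<open>S\<close> and \<open>S \<union> {u, v}\<close>, and, when \<open>u\<close> and \<open>v\<close> are not
    adjacent, also at \<open>S \<union> {u}\<close> and \<open>S \<union> {v}\<close>: order \<open>S\<close> first, then \<open>u\<close> and \<open>v\<close> tied.\<close>
  have curv: "0 \<le> curv u v S h \<and> ({u, v} \<notin> E \<longrightarrow> curv u v S h = 0)"
    if uv: "u \<noteq> v" "u \<notin> S" "v \<notin> S" for u v S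
  proof -
    define w :: "'v \<Rightarrow> real" where "w x = (if x \<in> S then 2 else if x \<in> {u, v} then 1 else 0)" for x
    obtain p where p: "p \<in> P"
      "\<And>T. \<forall>x y. {x, y} \<in> E \<longrightarrow> x \<in> T \<longrightarrow> y \<notin> T \<longrightarrow> w y < w x \<Longrightarrow> sign_vec T \<bullet> p = h $ T"
      using common[of w] by blast
    have "sign_vec S \<bullet> p = h $ S" "sign_vec (S \<union> {u, v}) \<bullet> p = h $ (S \<union> {u, v})"
      by (rule p(2); auto simp: w_def)+
    moreover have "sign_vec (S \<union> {u}) \<bullet> p + sign_vec (S \<union> {v}) \<bullet> p =
        sign_vec S \<bullet> p + sign_vec (S \<union> {u, v}) \<bullet> p"
      using sv[OF uv] by (metis inner_add_left)
    ultimately have "0 \<le> curv u v S h"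
      using h_max[OF p(1), of "S \<union> {u}"] h_max[OF p(1), of "S \<union> {v}"]
      by (simp only: curv_def)
    moreover have "curv u v S h = 0" if "{u, v} \<notin> E"
    proof -
      have "{v, u} \<notin> E" using that by (simp add: insert_commute)
      then have "sign_vec (S \<union> {u}) \<bullet> p = h $ (S \<union> {u})" "sign_vec (S \<union> {v}) \<bullet> p = h $ (S \<union> {v})"
        using that by - (rule p(2); auto simp: w_def)+
      then show ?thesis
        using \<open>sign_vec S \<bullet> p = h $ S\<close> \<open>sign_vec (S \<union> {u, v}) \<bullet> p = h $ (S \<union> {u, v})\<close>
          \<open>sign_vec (S \<union> {u}) \<bullet> p + sign_vec (S \<union> {v}) \<bullet> p =
            sign_vec S \<bullet> p + sign_vec (S \<union> {u, v}) \<bullet> p\<close>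
        by (simp only: curv_def)
    qed
    ultimately show ?thesis by blast
  qed
  have h0: "h $ {} = - h $ UNIV"
  proof -
    \<comment> \<open>For constant \<open>w\<close> exactly the sets without leaving edges qualify,
      among them \<open>{}\<close> and \<open>UNIV\<close>, whose sign vectors are opposite.\<close>
    obtain p where p: "\<And>T. \<forall>x y. {x, y} \<in> E \<longrightarrow> x \<in> T \<longrightarrow> y \<notin> T \<longrightarrow> (0::real) < 0 \<Longrightarrow>
        sign_vec T \<bullet> p = h $ T"
      using common[of "\<lambda>_. 0"] by blast
    from p[of "{}"] p[of UNIV] show ?thesis by (simp add: inner_sign_vec_UNIV)
  qed
  have "curv (us S) (vs S) (S - {us S, vs S}) h = 0" if "S \<in> nonclique_sets E" for S
    using ch that curv by (simp add: nonedge_choice_def)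
  then show "h \<in> C_cone E us vs"
    unfolding C_cone_iff_curv solution_space_iff_curv[OF ch]
    using h0 curv[OF inequality_indexD(2-4)[OF G]] by auto
  show "P = D_poly h"
  proof
    show "P \<subseteq> D_poly h" using h_max by (auto simp: mem_D_poly)
    show "D_poly h \<subseteq> P"
    proof
      fix x assume x: "x \<in> D_poly h"
      show "x \<in> P"
      proof (rule mem_polytope_if_dominated[OF P])
        fix w :: "real ^ 'v"
        obtain p where p: "p \<in> P"
          "\<And>T. \<forall>x y. {x, y} \<in> E \<longrightarrow> x \<in> T \<longrightarrow> y \<notin> T \<longrightarrow> w $ y < w $ x \<Longrightarrow> sign_vec T \<bullet> p = h $ T"
          using common[of "\<lambda>v. w $ v"] by blast
        have "sign_vec {v. t \<le> w $ v} \<bullet> p = h $ {v. t \<le> w $ v}" for t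
          by (rule p(2)) auto
        with p(1) x show "\<exists>p\<in>P. \<forall>t. sign_vec {v. t \<le> w $ v} \<bullet> x \<le> sign_vec {v. t \<le> w $ v} \<bullet> p"
          unfolding mem_D_poly by metis
      qed
    qed
  qed
qed

section \<open>The zonotope's own support vector\<close>

text \<open>The support values of the zonotope in the sign directions: an edge contributes 1 as soon
  as one endpoint lies in \<open>S\<close>.\<close>

definition zonotope_support :: "'v::finite set set \<Rightarrow> real ^ ('v set)" where
  "zonotope_support E = (\<chi> S. \<Sum>e\<in>E. if e \<inter> S = {} then - 1 else 1)"

text \<open>The scaled zonotope is a summand of itself with complement \<open>{0}\<close>, so the
  result on summands applies.\<close>

lemma zonotope_support_scaled:
  assumes "simple_graph E" "nonedge_choice E us vs" "0 \<le> c"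
  shows "c *\<^sub>R zonotope_support E \<in> C_cone E us vs"
    and "D_poly (c *\<^sub>R zonotope_support E) = (*\<^sub>R) c ` graphical_zonotope E"
proof -
  let ?Z = "(*\<^sub>R) c ` graphical_zonotope E"
  have poly: "polytope ?Z"
    by (intro polytope_linear_image polytope_graphical_zonotope) (auto intro!: linearI simp: algebra_simps)
  have split: "\<exists>f. \<forall>e\<in>E. f e \<in> e \<and> (\<forall>v\<in>e. sign_vec S $ v \<le> sign_vec S $ (f e)) \<and>
      sign_vec S $ (f e) = (if e \<inter> S = {} then - 1 else 1)" for S
  proof (rule bchoice, rule ballI)
    fix e assume "e \<in> E"
    show "\<exists>x. x \<in> e \<and> (\<forall>v\<in>e. sign_vec S $ v \<le> sign_vec S $ x) \<and>
        sign_vec S $ x = (if e \<inter> S = {} then - 1 else 1)"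
    proof (cases "e \<inter> S = {}")
      case True
      then show ?thesis
        using simple_graph_edge(1)[OF assms(1) \<open>e \<in> E\<close>] by (auto simp: sign_vec_def disjoint_iff)
    next
      case False
      then show ?thesis by (auto simp: sign_vec_def)
    qed
  qed
  have att: "\<exists>p\<in>?Z. sign_vec S \<bullet> p = (c *\<^sub>R zonotope_support E) $ S" for S
  proof -
    obtain f where f: "\<And>e. e \<in> E \<Longrightarrow> f e \<in> e"
      "\<And>e. e \<in> E \<Longrightarrow> sign_vec S $ (f e) = (if e \<inter> S = {} then - 1 else 1)"
      using split[of S] by blast
    have "c *\<^sub>R (\<Sum>e\<in>E. axis (f e) 1) \<in> ?Z"
      using vertex_sum_mem_graphical_zonotope[OF f(1)] by blast
    moreover have "sign_vec S \<bullet> (c *\<^sub>R (\<Sum>e\<in>E. axis (f e) 1)) = (c *\<^sub>R zonotope_support E) $ S"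
      using f(2) by (simp add: inner_sum_right inner_axis zonotope_support_def cong: sum.cong)
    ultimately show ?thesis by blast
  qed
  have max: "sign_vec S \<bullet> x \<le> (c *\<^sub>R zonotope_support E) $ S" if x: "x \<in> ?Z" for S x
  proof -
    obtain f where f:
      "\<And>e v. e \<in> E \<Longrightarrow> v \<in> e \<Longrightarrow> sign_vec S $ v \<le> sign_vec S $ (f e)"
      "\<And>e. e \<in> E \<Longrightarrow> sign_vec S $ (f e) = (if e \<inter> S = {} then - 1 else 1)"
      using split[of S] by blast
    obtain y where y: "y \<in> graphical_zonotope E" "x = c *\<^sub>R y" using x by blast
    have "sign_vec S \<bullet> y \<le> zonotope_support E $ S"
      using inner_graphical_zonotope_le[OF y(1), of "sign_vec S" f] f
      by (simp add: zonotope_support_def cong: sum.cong)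
    then show ?thesis using \<open>0 \<le> c\<close> by (simp add: y(2) mult_left_mono)
  qed
  have ne: "?Z \<noteq> {}" using att by blast
  have Q: "?Z + {0} = ?Z" by (simp flip: set_zero)
  show "c *\<^sub>R zonotope_support E \<in> C_cone E us vs"
    by (rule deformation_eq_D_poly(1)[OF assms(1,2) poly ne Q \<open>0 \<le> c\<close> att max])
  show "D_poly (c *\<^sub>R zonotope_support E) = ?Z"
    by (rule deformation_eq_D_poly(2)[OF assms(1,2) poly ne Q \<open>0 \<le> c\<close> att max, symmetric])
qed

text \<open>No edge contributes negatively, and the edge \<open>{u, v}\<close> contributes 2. The
  zonotope thus satisfies all inequalities with uniform slack.\<close>

lemma curv_zonotope_support:
  assumes "simple_graph E" "inequality_index E u v S"
  shows "2 \<le> curv u v S (zonotope_support E)"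
proof -
  note uv = inequality_indexD[OF assms]
  define \<phi> :: "'a set \<Rightarrow> 'a set \<Rightarrow> real" where "\<phi> T e = (if e \<inter> T = {} then - 1 else 1)" for T e
  define \<tau> where "\<tau> e = \<phi> (S \<union> {u}) e + \<phi> (S \<union> {v}) e - \<phi> S e - \<phi> (S \<union> {u, v}) e" for e
  have "curv u v S (zonotope_support E) = (\<Sum>e\<in>E. \<tau> e)"
    by (simp add: curv_def zonotope_support_def \<tau>_def \<phi>_def sum.distrib sum_subtractf)
  moreover have "\<tau> {u, v} \<le> (\<Sum>e\<in>E. \<tau> e)"
    using uv(1) by (intro member_le_sum) (auto simp: \<tau>_def \<phi>_def)
  moreover have "\<tau> {u, v} = 2"
    using uv(2-4) by (auto simp: \<tau>_def \<phi>_def)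
  ultimately show ?thesis by simp
qed

lemma deformation_cone_graphical_zonotope:
  assumes G: "simple_graph E" and ch: "nonedge_choice E us vs"
  shows "deformation_cone (graphical_zonotope E) = {D_poly h |h. h \<in> C_cone E us vs}"
proof (intro equalityI subsetI)
  fix P assume "P \<in> deformation_cone (graphical_zonotope E)"
  then obtain c Q where P: "polytope P" "P \<noteq> {}" "0 \<le> c" "P + Q = (*\<^sub>R) c ` graphical_zonotope E"
    by (auto simp: deformation_cone_def deformation_of_def)
  have "\<exists>p\<in>P. \<forall>x\<in>P. sign_vec S \<bullet> x \<le> sign_vec S \<bullet> p" for S
    using polytope_imp_compact[OF P(1)] P(2)
    by (intro continuous_attains_sup) (auto intro!: continuous_intros)
  then obtain m where m: "\<And>S. m S \<in> P" "\<And>S x. x \<in> P \<Longrightarrow> sign_vec S \<bullet> x \<le> sign_vec S \<bullet> m S"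
    by metis
  define h where "h = (\<chi> S. sign_vec S \<bullet> m S)"
  have "h \<in> C_cone E us vs \<and> P = D_poly h"
    using m deformation_eq_D_poly[OF G ch P(1,2,4,3), of h] by (auto simp: h_def)
  then show "P \<in> {D_poly h |h. h \<in> C_cone E us vs}" by blast
next
  fix P assume "P \<in> {D_poly h |h. h \<in> C_cone E us vs}"
  then obtain h where h: "h \<in> C_cone E us vs" "P = D_poly h" by blast
  \<comment> \<open>The zonotope has second differences at least 2, so this multiple has at least
    \<open>4 * norm h\<close>, which absorbs those of \<open>h\<close>.\<close>
  let ?k = "(2 * norm h) *\<^sub>R zonotope_support E"
  define g where "g = ?k - h"
  have k: "?k \<in> C_cone E us vs" "D_poly ?k = (*\<^sub>R) (2 * norm h) ` graphical_zonotope E"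
    by (rule zonotope_support_scaled[OF G ch]; simp)+
  have g: "g \<in> C_cone E us vs"
    unfolding C_cone_iff_curv
  proof (intro conjI allI impI)
    show "g \<in> solution_space E us vs"
      using k(1) h(1) unfolding g_def C_cone_iff_curv
      by (intro subspace_diff[OF subspace_solution_space]) auto
    show "0 \<le> curv u v S g" if "inequality_index E u v S" for u v S
    proof -
      have "curv u v S g = (2 * norm h) * curv u v S (zonotope_support E) - curv u v S h"
        unfolding g_def by (simp add: linear_diff[OF linear_curv] linear_scale[OF linear_curv])
      moreover have "2 * norm h * 2 \<le> 2 * norm h * curv u v S (zonotope_support E)"
        using curv_zonotope_support[OF G that] by (intro mult_left_mono) auto
      ultimately show ?thesis using curv_bound[of u v S h] by linarith
    qed
  qed
  have "D_poly h + D_poly g = (*\<^sub>R) (2 * norm h) ` graphical_zonotope E"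
    using D_poly_add[OF ch h(1) g] k by (simp add: g_def)
  then have "P deformation_of graphical_zonotope E"
    unfolding deformation_of_def h(2)
    using D_poly_nonempty[OF ch h(1)] D_poly_nonempty[OF ch g]
    by (intro conjI polytope_D_poly exI[of _ "2 * norm h"] exI[of _ "D_poly g"]) auto
  then show "P \<in> deformation_cone (graphical_zonotope E)" by (simp add: deformation_cone_def)
qed

section \<open>Facets and independence of the equations\<close>

lemma C_cone_add: "g \<in> C_cone E us vs \<Longrightarrow> h \<in> C_cone E us vs \<Longrightarrow> g + h \<in> C_cone E us vs"
  unfolding C_cone_iff_curv
  by (auto simp: linear_add[OF linear_curv] intro: subspace_add[OF subspace_solution_space])

lemma C_cone_scale: "h \<in> C_cone E us vs \<Longrightarrow> 0 \<le> c \<Longrightarrow> c *\<^sub>R h \<in> C_cone E us vs"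
  unfolding C_cone_iff_curv
  by (auto simp: linear_scale[OF linear_curv] intro: subspace_scale[OF subspace_solution_space])

lemma C_cone_0: "0 \<in> C_cone E us vs"
  unfolding C_cone_iff_curv
  by (auto simp: linear_0[OF linear_curv] intro: subspace_0[OF subspace_solution_space])

lemma C_cone_sum: "(\<And>i. i \<in> I \<Longrightarrow> h i \<in> C_cone E us vs) \<Longrightarrow> sum h I \<in> C_cone E us vs"
  by (induction I rule: infinite_finite_induct) (auto simp: C_cone_0 C_cone_add)

lemma convex_C_cone: "convex (C_cone E us vs)"
  by (auto simp: convex_def intro!: C_cone_add C_cone_scale)

lemma C_coneI:
  assumes "simple_graph E" "nonedge_choice E us vs" "h $ {} = - h $ UNIV"
    and "\<And>u v S. u \<noteq> v \<Longrightarrow> u \<notin> S \<Longrightarrow> v \<notin> S \<Longrightarrow> 0 \<le> curv u v S h"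
    and "\<And>u v S. u \<noteq> v \<Longrightarrow> u \<notin> S \<Longrightarrow> v \<notin> S \<Longrightarrow> {u, v} \<notin> E \<Longrightarrow> curv u v S h = 0"
  shows "h \<in> C_cone E us vs"
proof -
  have "curv (us S) (vs S) (S - {us S, vs S}) h = 0" if "S \<in> nonclique_sets E" for S
    using assms(2) that by (intro assms(5)) (auto simp: nonedge_choice_def)
  moreover have "0 \<le> curv u v S h" if "inequality_index E u v S" for u v S
    using inequality_indexD[OF assms(1) that] by (intro assms(4))
  ultimately show ?thesis
    using assms(3) by (simp add: C_cone_iff_curv solution_space_iff_curv[OF assms(2)])
qed

text \<open>
  Two vectors of the cone attached to a clique, up to normalization the functions
  \<open>S \<mapsto> [K \<inter> S \<noteq> {}]\<close> (a simplex) and \<open>S \<mapsto> - [K \<subseteq> S]\<close> (its negative).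
  Edges and triangles suffice to separate the inequalities.
\<close>

definition meet_vec :: "'v::finite set \<Rightarrow> real ^ ('v set)" where
  "meet_vec K = (\<chi> S. if K \<inter> S = {} then - 1 else 1)"

definition contain_vec :: "'v::finite set \<Rightarrow> real ^ ('v set)" where
  "contain_vec K = (\<chi> S. if K \<subseteq> S then - 1 else 1)"

lemma curv_meet_vec:
  assumes "u \<noteq> v" "u \<notin> S" "v \<notin> S"
  shows "curv u v S (meet_vec K) = (if u \<in> K \<and> v \<in> K \<and> K \<inter> S = {} then 2 else 0)"
  using assms by (auto simp: curv_def meet_vec_def)

lemma curv_contain_vec:
  assumes "u \<noteq> v" "u \<notin> S" "v \<notin> S"
  shows "curv u v S (contain_vec K) = (if u \<in> K \<and> v \<in> K \<and> K \<subseteq> S \<union> {u, v} then 2 else 0)"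
proof -
  have "K \<subseteq> S \<union> {u} \<longleftrightarrow> v \<notin> K \<and> K \<subseteq> S \<union> {u, v}" "K \<subseteq> S \<union> {v} \<longleftrightarrow> u \<notin> K \<and> K \<subseteq> S \<union> {u, v}"
    "K \<subseteq> S \<longleftrightarrow> u \<notin> K \<and> v \<notin> K \<and> K \<subseteq> S \<union> {u, v}"
    using assms by auto
  then show ?thesis
    by (simp add: curv_def contain_vec_def del: Un_insert_right)
qed

lemma clique_vecs_mem_C_cone:
  assumes "simple_graph E" "nonedge_choice E us vs" "induces_clique E K" "K \<noteq> {}"
  shows "meet_vec K \<in> C_cone E us vs" "contain_vec K \<in> C_cone E us vs"
proof -
  show "meet_vec K \<in> C_cone E us vs"
  proof (rule C_coneI[OF assms(1,2)])
    show "meet_vec K $ {} = - meet_vec K $ UNIV"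
      using assms(4) by (simp add: meet_vec_def)
  qed (use assms(3) in \<open>auto simp: curv_meet_vec induces_clique_def\<close>)
  show "contain_vec K \<in> C_cone E us vs"
  proof (rule C_coneI[OF assms(1,2)])
    show "contain_vec K $ {} = - contain_vec K $ UNIV"
      using assms(4) by (simp add: contain_vec_def)
  qed (use assms(3) in \<open>auto simp: curv_contain_vec induces_clique_def\<close>)
qed

text \<open>For distinct edges the segment of \<open>{a, b}\<close> is flat along
  \<open>{u, v}\<close>. For equal edges, a vertex \<open>x\<close> in just one of \<open>S\<close>
  and \<open>T\<close> spans a triangle with the edge: \<open>contain_vec\<close> sees only base
  sets containing \<open>x\<close>, \<open>meet_vec\<close> only those avoiding it.\<close>

lemma separating_vector:
  assumes G: "simple_graph E" and ch: "nonedge_choice E us vs"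
    and i: "inequality_index E u v S" and j: "inequality_index E a b T"
    and ne: "({u, v}, S) \<noteq> ({a, b}, T)"
  shows "\<exists>h\<in>C_cone E us vs. curv u v S h = 0 \<and> 0 < curv a b T h"
proof -
  note iD = inequality_indexD[OF G i] and jD = inequality_indexD[OF G j]
  note mem = clique_vecs_mem_C_cone[OF G ch]
  consider (edge) "{u, v} \<noteq> {a, b}" | (less) x where "{u, v} = {a, b}" "x \<in> T" "x \<notin> S"
    | (more) x where "{u, v} = {a, b}" "x \<in> S" "x \<notin> T"
    using ne by auto
  then show ?thesis
  proof cases
    case edge
    have "\<not> (u \<in> {a, b} \<and> v \<in> {a, b})"
      using edge iD(2) by auto
    then have "curv u v S (meet_vec {a, b}) = 0"
      by (auto simp: curv_meet_vec[OF iD(2-4)])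
    moreover have "0 < curv a b T (meet_vec {a, b})"
      using jD(3,4) by (simp add: curv_meet_vec[OF jD(2-4)])
    moreover have "induces_clique E {a, b}"
      using jD(1) by (auto simp: induces_clique_def insert_commute)
    ultimately show ?thesis using mem by blast
  next
    case less
    have clique: "induces_clique E {a, b, x}"
      using jD(1) j less(2) by (auto simp: induces_clique_def inequality_index_def nbhd_def insert_commute)
    have "x \<noteq> u" "x \<noteq> v" using less jD by auto
    then have "curv u v S (contain_vec {a, b, x}) = 0" "0 < curv a b T (contain_vec {a, b, x})"
      using iD jD less by (auto simp: curv_contain_vec)
    then show ?thesis using mem[OF clique] by blast
  next
    case more
    have clique: "induces_clique E {u, v, x}"
      using iD(1) i more(2) by (auto simp: induces_clique_def inequality_index_def nbhd_def insert_commute)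
    have "{u, v, x} \<inter> T = {}" "a \<in> {u, v, x}" "b \<in> {u, v, x}"
      using more jD by auto
    then have "curv u v S (meet_vec {u, v, x}) = 0" "0 < curv a b T (meet_vec {u, v, x})"
      using iD jD more by (auto simp: curv_meet_vec)
    then show ?thesis using mem[OF clique] by blast
  qed
qed

lemma tight_face_distinct:
  assumes "simple_graph E" "nonedge_choice E us vs"
    and "inequality_index E u v S" "inequality_index E a b T" "({u, v}, S) \<noteq> ({a, b}, T)"
  shows "tight_face E us vs u v S \<noteq> tight_face E us vs a b T"
proof -
  obtain h where "h \<in> C_cone E us vs" "curv u v S h = 0" "0 < curv a b T h"
    using separating_vector[OF assms] by blast
  then have "h \<in> tight_face E us vs u v S" "h \<notin> tight_face E us vs a b T"
    by (auto simp: tight_face_iff_curv)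
  then show ?thesis by blast
qed

section \<open>Linear spans of the cone and its facets\<close>

lemma zonotope_support_mem_C_cone:
  assumes "simple_graph E" "nonedge_choice E us vs"
  shows "zonotope_support E \<in> C_cone E us vs"
  using zonotope_support_scaled(1)[OF assms, of 1] by simp

text \<open>Slack in \<open>g\<close> is needed only where \<open>s\<close> has a nonzero second
  difference. This covers perturbations of interior points of the cone as well as those inside a
  facet.\<close>

lemma C_cone_absorb:
  assumes g: "g \<in> C_cone E us vs" and s: "s \<in> solution_space E us vs" and "0 \<le> c"
    and bound: "\<And>u v S. inequality_index E u v S \<Longrightarrow> curv u v S s \<noteq> 0 \<Longrightarrow> 4 * norm s \<le> c * curv u v S g"
  shows "c *\<^sub>R g + s \<in> C_cone E us vs"
  unfolding C_cone_iff_curv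
proof (intro conjI allI impI)
  show "c *\<^sub>R g + s \<in> solution_space E us vs"
    using g s unfolding C_cone_iff_curv
    by (intro subspace_add[OF subspace_solution_space] subspace_scale[OF subspace_solution_space]) auto
  fix u v S assume i: "inequality_index E u v S"
  have eq: "curv u v S (c *\<^sub>R g + s) = c * curv u v S g + curv u v S s"
    by (simp add: linear_add[OF linear_curv] linear_scale[OF linear_curv])
  show "0 \<le> curv u v S (c *\<^sub>R g + s)"
  proof (cases "curv u v S s = 0")
    case True
    then show ?thesis using eq g i \<open>0 \<le> c\<close> by (simp add: C_cone_iff_curv)
  next
    case False
    then show ?thesis using eq bound[OF i False] curv_bound[of u v S s] by linarith
  qed
qed

text \<open>Adding a large multiple of the zonotope's support vector moves any solution into the
  cone, so it is a difference of two cone elements.\<close>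

lemma solution_space_eq_span:
  assumes G: "simple_graph E" and ch: "nonedge_choice E us vs"
  shows "solution_space E us vs = span (C_cone E us vs)"
proof
  show "span (C_cone E us vs) \<subseteq> solution_space E us vs"
    by (intro span_minimal subspace_solution_space) (auto simp: C_cone_def)
  show "solution_space E us vs \<subseteq> span (C_cone E us vs)"
  proof
    fix s assume s: "s \<in> solution_space E us vs"
    let ?k = "(2 * norm s) *\<^sub>R zonotope_support E"
    have "4 * norm s \<le> 2 * norm s * curv u v S (zonotope_support E)"
      if "inequality_index E u v S" for u v S
      using mult_left_mono[OF curv_zonotope_support[OF G that], of "2 * norm s"] by simp
    then have "?k + s \<in> C_cone E us vs"
      by (intro C_cone_absorb[OF zonotope_support_mem_C_cone[OF G ch] s]) auto
    moreover have "?k \<in> C_cone E us vs"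
      by (simp add: zonotope_support_scaled(1)[OF G ch])
    ultimately have "(?k + s) - ?k \<in> span (C_cone E us vs)"
      by (intro span_diff span_base)
    then show "s \<in> span (C_cone E us vs)" by simp
  qed
qed

lemma tight_face_relative_interior_point:
  assumes G: "simple_graph E" and ch: "nonedge_choice E us vs" and i: "inequality_index E u v S"
  obtains g where "g \<in> tight_face E us vs u v S"
    "\<And>a b T. inequality_index E a b T \<Longrightarrow> ({u, v}, S) \<noteq> ({a, b}, T) \<Longrightarrow> 0 < curv a b T g"
proof -
  \<comment> \<open>Indices are ordered triples; comparing edges as sets also excludes the given
    inequality with \<open>u\<close> and \<open>v\<close> swapped.\<close>
  define I where "I = {(a, b, T). inequality_index E a b T \<and> ({u, v}, S) \<noteq> ({a, b}, T)}"
  have "\<forall>k\<in>I. \<exists>h. h \<in> C_cone E us vs \<and> curv u v S h = 0 \<and>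
      0 < curv (fst k) (fst (snd k)) (snd (snd k)) h"
    using separating_vector[OF G ch i] by (force simp: I_def)
  from bchoice[OF this] obtain H where H: "\<forall>k\<in>I. H k \<in> C_cone E us vs \<and> curv u v S (H k) = 0 \<and>
      0 < curv (fst k) (fst (snd k)) (snd (snd k)) (H k)" ..
  define g where "g = sum H I"
  have gC: "g \<in> C_cone E us vs"
    unfolding g_def using H by (intro C_cone_sum) blast
  have "curv u v S g = 0"
    unfolding g_def linear_sum[OF linear_curv] using H by simp
  moreover have "0 < curv a b T g"
    if ab: "inequality_index E a b T" "({u, v}, S) \<noteq> ({a, b}, T)" for a b T
  proof -
    have k: "(a, b, T) \<in> I" using ab by (simp add: I_def)
    have "0 < curv a b T (H (a, b, T))" using H k by force
    also have "\<dots> \<le> (\<Sum>k\<in>I. curv a b T (H k))"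
      using k H ab(1) by (intro member_le_sum) (auto simp: C_cone_iff_curv)
    finally show ?thesis unfolding g_def linear_sum[OF linear_curv] .
  qed
  ultimately show ?thesis
    using gC by (intro that[of g]) (auto simp: tight_face_iff_curv)
qed

lemma span_tight_face:
  assumes G: "simple_graph E" and ch: "nonedge_choice E us vs" and i: "inequality_index E u v S"
  shows "span (tight_face E us vs u v S) = {h \<in> solution_space E us vs. curv u v S h = 0}"
    (is "span ?F = ?X")
proof
  have "subspace ?X"
    using subspace_inter[OF subspace_solution_space linear_subspace_kernel[OF linear_curv]]
    by (simp add: Int_def)
  then show "span ?F \<subseteq> ?X"
    by (intro span_minimal) (auto simp: tight_face_iff_curv C_cone_iff_curv)
  obtain g where g: "g \<in> ?F"
    "\<And>a b T. inequality_index E a b T \<Longrightarrow> ({u, v}, S) \<noteq> ({a, b}, T) \<Longrightarrow> 0 < curv a b T g"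
    using tight_face_relative_interior_point[OF G ch i] by metis
  show "?X \<subseteq> span ?F"
  proof
    fix s assume s: "s \<in> ?X"
    define I where "I = {(a, b, T). inequality_index E a b T \<and> curv a b T s \<noteq> 0}"
    \<comment> \<open>The sum of all required ratios is at least each of them, which avoids a
      maximum over a possibly empty set.\<close>
    define c where "c = (\<Sum>(a, b, T)\<in>I. 4 * norm s / curv a b T g)"
    have pos: "0 < curv a b T g" if "(a, b, T) \<in> I" for a b T
    proof (rule g(2))
      show "({u, v}, S) \<noteq> ({a, b}, T)"
        using that s curv_commute[of a b T s] by (auto simp: I_def doubleton_eq_iff)
    qed (use that in \<open>simp add: I_def\<close>)
    have c_ge: "4 * norm s \<le> c * curv a b T g" if "(a, b, T) \<in> I" for a b T
    proof -
      have "(case (a, b, T) of (a, b, T) \<Rightarrow> 4 * norm s / curv a b T g) \<le> c"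
        unfolding c_def using that pos by (intro member_le_sum) (auto intro!: divide_nonneg_pos)
      then show ?thesis using pos[OF that] by (simp add: field_simps)
    qed
    have "0 \<le> c"
      unfolding c_def using pos by (intro sum_nonneg) (auto intro!: divide_nonneg_pos)
    have gC: "g \<in> C_cone E us vs" "curv u v S g = 0"
      using g(1) by (auto simp: tight_face_iff_curv)
    have "c *\<^sub>R g + s \<in> C_cone E us vs"
      using s c_ge \<open>0 \<le> c\<close> by (intro C_cone_absorb[OF gC(1)]) (auto simp: I_def)
    then have "c *\<^sub>R g + s \<in> ?F"
      using s gC(2) by (simp add: tight_face_iff_curv linear_add[OF linear_curv] linear_scale[OF linear_curv])
    then have "(c *\<^sub>R g + s) - c *\<^sub>R g \<in> span ?F"
      using g(1) by (intro span_diff span_scale span_base)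
    then show "s \<in> span ?F" by simp
  qed
qed

text \<open>The zonotope's support vector lies off the hyperplane, and with the face it spans the
  solution space, so the dimension drops by exactly one. Both cones contain 0, so affine and linear
  dimension agree.\<close>

lemma tight_face_facet_of:
  assumes G: "simple_graph E" and ch: "nonedge_choice E us vs" and i: "inequality_index E u v S"
  shows "tight_face E us vs u v S facet_of C_cone E us vs"
proof -
  let ?F = "tight_face E us vs u v S" and ?C = "C_cone E us vs" and ?z = "zonotope_support E"
  define a :: "real ^ ('a set)" where
    "a = axis (S \<union> {u}) 1 + axis (S \<union> {v}) 1 - axis S 1 - axis (S \<union> {u, v}) 1"
  have a: "a \<bullet> h = curv u v S h" for h
    by (simp add: a_def curv_def inner_add_left inner_diff_left inner_axis')
  have F: "?F = ?C \<inter> {h. a \<bullet> h = 0}"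
    by (auto simp: a tight_face_iff_curv)
  have face: "?F face_of ?C"
    unfolding F using i
    by (intro face_of_Int_supporting_hyperplane_ge convex_C_cone) (auto simp: a C_cone_iff_curv)
  have F0: "0 \<in> ?F"
    by (simp add: tight_face_iff_curv C_cone_0 linear_0[OF linear_curv])
  have z: "?z \<in> solution_space E us vs" "curv u v S ?z \<noteq> 0"
    using zonotope_support_mem_C_cone[OF G ch] curv_zonotope_support[OF G i]
    by (auto simp: C_cone_def)
  have "solution_space E us vs \<subseteq> span (insert ?z ?F)"
  proof
    fix s assume s: "s \<in> solution_space E us vs"
    \<comment> \<open>Chosen to make the second difference of \<open>s - t *\<^sub>R ?z\<close>
      vanish.\<close>
    define t where "t = curv u v S s / curv u v S ?z"
    have "s - t *\<^sub>R ?z \<in> span ?F"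
      unfolding span_tight_face[OF G ch i] using s z
      by (auto simp: t_def linear_diff[OF linear_curv] linear_scale[OF linear_curv]
          intro!: subspace_diff[OF subspace_solution_space] subspace_scale[OF subspace_solution_space])
    then show "s \<in> span (insert ?z ?F)"
      unfolding span_insert by blast
  qed
  moreover have "span (insert ?z ?F) \<subseteq> solution_space E us vs"
    using z(1) by (intro span_minimal subspace_solution_space) (auto simp: F C_cone_def)
  ultimately have "span ?C = span (insert ?z ?F)"
    using solution_space_eq_span[OF G ch] by auto
  then have "dim ?C = dim (insert ?z ?F)"
    by (metis dim_span)
  also have "\<dots> = dim ?F + 1"
    using z(2) by (simp add: dim_insert span_tight_face[OF G ch i])
  finally have "aff_dim ?F = aff_dim ?C - 1"
    using F0 C_cone_0[of E us vs] by (simp add: aff_dim_zero hull_inc)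
  with face F0 show ?thesis unfolding facet_of_def by blast
qed

section \<open>Linear independence of the equations\<close>

text \<open>Since \<open>independent\<close> concerns sets, repeated vectors must be ruled out
  separately; coefficients 1 and -1 at two equal members do this.\<close>

lemma inj_independent_familyI:
  fixes f :: "'i \<Rightarrow> 'a::real_vector"
  assumes "finite I"
    and zero: "\<And>c i. (\<Sum>i\<in>I. c i *\<^sub>R f i) = 0 \<Longrightarrow> i \<in> I \<Longrightarrow> c i = 0"
  shows "inj_on f I \<and> independent (f ` I)"
proof
  show inj: "inj_on f I"
  proof (rule inj_onI, rule ccontr)
    fix i j assume ij: "i \<in> I" "j \<in> I" "f i = f j" "i \<noteq> j"
    let ?c = "\<lambda>k. if k = i then 1 else if k = j then - 1 else (0::real)"
    have "(\<Sum>k\<in>I. ?c k *\<^sub>R f k) = (\<Sum>k\<in>{i, j}. ?c k *\<^sub>R f k)"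
      using ij assms(1) by (intro sum.mono_neutral_right) auto
    also have "\<dots> = 0" using ij by simp
    finally show False using zero[of ?c i] ij(1) by simp
  qed
  show "independent (f ` I)"
  proof
    assume "dependent (f ` I)"
    then obtain c where c: "\<exists>x\<in>f ` I. c x \<noteq> 0" "(\<Sum>x\<in>f ` I. c x *\<^sub>R x) = 0"
      using dependent_finite[of "f ` I"] assms(1) by auto
    have "(\<Sum>i\<in>I. c (f i) *\<^sub>R f i) = 0"
      using c(2) by (simp add: sum.reindex[OF inj])
    then show False using zero[of "\<lambda>i. c (f i)"] c(1) by blast
  qed
qed

text \<open>The system is triangular: apart from the equation of \<open>None\<close>, the entry at
  \<open>S\<close> occurs only in the equations of \<open>S\<close> and of strict supersets.
  Coefficients therefore vanish by induction from large sets to small.\<close>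

lemma equation_coeffs_independent:
  fixes E :: "'v::finite set set"
  assumes ch: "nonedge_choice E us vs"
  shows "inj_on (equation_coeffs us vs) (equation_indices E) \<and>
    independent (equation_coeffs us vs ` equation_indices E)"
proof (rule inj_independent_familyI)
  show "finite (equation_indices E)" by simp
  fix c i
  assume sum0: "(\<Sum>i\<in>equation_indices E. c i *\<^sub>R equation_coeffs us vs i) = 0"
    and i: "i \<in> equation_indices E"
  have comp: "(\<Sum>i\<in>equation_indices E. c i * (equation_coeffs us vs i \<bullet> h)) = 0" for h
    using arg_cong[OF sum0, of "\<lambda>x. x \<bullet> h"] by (simp add: inner_sum_left)
  \<comment> \<open>Equations of non-cliques vanish on constant vectors, which isolates the
    coefficient of \<open>None\<close>.\<close>
  have one: "equation_coeffs us vs i \<bullet> (\<chi> S. 1) = (if i = None then 2 else 0)" for i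
    by (cases i) (simp_all add: equation_coeffs_def inner_add_left inner_diff_left inner_axis')
  have None: "c None = 0"
    using comp[of "\<chi> S. 1"] unfolding one by (simp add: equation_indices_def sum.reindex)
  have Some: "c (Some S) = 0" if "S \<in> nonclique_sets E" for S
    using that
  proof (induction "CARD('v) - card S" arbitrary: S rule: less_induct)
    case less
    have uv: "us T \<in> T" "vs T \<in> T" if "T \<in> nonclique_sets E" for T
      using ch that by (auto simp: nonedge_choice_def)
    have "c j * (equation_coeffs us vs j \<bullet> axis S 1) = 0"
      if j: "j \<in> equation_indices E - {Some S}" for j
    proof (cases j)
      case (Some T)
      with j have T: "T \<in> nonclique_sets E" "T \<noteq> S"
        by (auto simp: equation_indices_def)
      show ?thesis
      proof (cases "S \<subset> T")
        case True
        then have "card S < card T" by (simp add: psubset_card_mono)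
        moreover have "card T \<le> CARD('v)" by (simp add: card_mono)
        ultimately have "c (Some T) = 0" using T(1) by (intro less.hyps) auto
        then show ?thesis using Some by simp
      next
        case False
        then have "T - {us T} \<noteq> S" "T - {vs T} \<noteq> S" "T - {us T, vs T} \<noteq> S"
          using uv[OF T(1)] by auto
        then show ?thesis
          using Some T(2) unfolding inner_axis by (simp add: equation_coeffs_def axis_def)
      qed
    qed (simp add: None)
    then have "(\<Sum>j\<in>equation_indices E. c j * (equation_coeffs us vs j \<bullet> axis S 1)) =
        (\<Sum>j\<in>{Some S}. c j * (equation_coeffs us vs j \<bullet> axis S 1))"
      using less.prems by (intro sum.mono_neutral_right) (auto simp: equation_indices_def)
    moreover have "S - {us S} \<noteq> S" "S - {vs S} \<noteq> S" "S - {us S, vs S} \<noteq> S"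
      using uv[OF less.prems] by auto
    then have "equation_coeffs us vs (Some S) \<bullet> axis S 1 = - 1"
      unfolding inner_axis by (simp add: equation_coeffs_def axis_def)
    ultimately show ?case using comp[of "axis S 1"] by simp
  qed
  show "c i = 0"
    using i None Some by (auto simp: equation_indices_def)
qed

theorem theorem2p6:
  fixes E :: "'v::finite set set"
    and us vs :: "'v set \<Rightarrow> 'v"
  assumes "simple_graph E"
    and "nonedge_choice E us vs"
  shows "deformation_cone (graphical_zonotope E) = {D_poly h |h. h \<in> C_cone E us vs} \<and>
    (inj_on (equation_coeffs us vs) (equation_indices E) \<and>
     independent (equation_coeffs us vs ` equation_indices E)) \<and>
    solution_space E us vs = span (C_cone E us vs) \<and>
    (\<forall>u v S. inequality_index E u v S \<longrightarrow>
       tight_face E us vs u v S facet_of C_cone E us vs) \<and>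
    (\<forall>u v S u' v' S'.
       inequality_index E u v S \<longrightarrow> inequality_index E u' v' S' \<longrightarrow>
       ({u, v}, S) \<noteq> ({u', v'}, S') \<longrightarrow>
       tight_face E us vs u v S \<noteq> tight_face E us vs u' v' S')"
proof (intro conjI)
  show "deformation_cone (graphical_zonotope E) = {D_poly h |h. h \<in> C_cone E us vs}"
    by (rule deformation_cone_graphical_zonotope[OF assms])
  show "inj_on (equation_coeffs us vs) (equation_indices E)"
    "independent (equation_coeffs us vs ` equation_indices E)"
    using equation_coeffs_independent[OF assms(2)] by blast+
  show "solution_space E us vs = span (C_cone E us vs)"
    by (rule solution_space_eq_span[OF assms])
  show "\<forall>u v S. inequality_index E u v S \<longrightarrow>
      tight_face E us vs u v S facet_of C_cone E us vs"
    using tight_face_facet_of[OF assms] by blast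
  show "\<forall>u v S u' v' S'. inequality_index E u v S \<longrightarrow> inequality_index E u' v' S' \<longrightarrow>
      ({u, v}, S) \<noteq> ({u', v'}, S') \<longrightarrow>
      tight_face E us vs u v S \<noteq> tight_face E us vs u' v' S'"
    using tight_face_distinct[OF assms] by blast
qed

end
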